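(* Let $T$ be a splitting tree. Then there is a splitting tree $S \subseteq T$ such that $S \not\rightarrow_{\mathrm{cont}} (\mathbb{SP})^2_2$, i.e. there is a continuous coloring $c \colon [[S]]^2 \to 2$ such that there is no splitting tree $R \subseteq S$ with $c$ constant on $[[R]]^2$.
   Context: A tree is a set $T \subseteq 2^{<\omega}$ closed under initial segments; $[T]$ is its set of infinite branches (a subspace of $2^\omega$), and $[[T]]^2$ is the set of two-element subsets of $[T]$. For $t \in T$, $T \restriction t = \{ s \in T : s \subseteq t \text{ or } t \subseteq s\}$. For $a \subseteq \omega$ and $X \subseteq 2^{\leq \omega}$, $X$ covers $a$ if for every $n \in a$ and $i \in 2$ there is $s \in X$ with $n \in \operatorname{dom}(s)$ and $s(n) = i$. A tree $T \subseteq 2^{<\omega}$ is a splitting tree if for every $t \in T$, $T \restriction t$ covers a cofinite subset of $\omega$; $\mathbb{SP}$ denotes the set of splitting trees. *)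

theory Defs
  imports "HOL-Analysis.Analysis" "HOL-Library.Ramsey" "HOL-Library.Sublist"
begin

text \<open>
  Finite binary sequences are boolean lists, with \<^const>\<open>prefix\<close> as the initial-segment relation;
  \<open>2\<^sup>\<omega>\<close> is the type \<^typ>\<open>nat \<Rightarrow> bool\<close>, whose type-class topology is the product of the
  discrete topology on \<^typ>\<open>bool\<close>.
\<close>

definition is_tree :: "bool list set \<Rightarrow> bool" where
  "is_tree T \<longleftrightarrow> (\<forall>t\<in>T. \<forall>s. prefix s t \<longrightarrow> s \<in> T)"

definition branches :: "bool list set \<Rightarrow> (nat \<Rightarrow> bool) set" where
  "branches T = {x. \<forall>n. map x [0..<n] \<in> T}"

definition tree_restrict :: "bool list set \<Rightarrow> bool list \<Rightarrow> bool list set" where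
  "tree_restrict T t = {s \<in> T. prefix s t \<or> prefix t s}"

text \<open>Covering is only needed for sets of finite sequences.\<close>

definition covers :: "bool list set \<Rightarrow> nat set \<Rightarrow> bool" where
  "covers X a \<longleftrightarrow> (\<forall>n\<in>a. \<forall>i. \<exists>s\<in>X. n < length s \<and> s ! n = i)"

text \<open>
  The empty tree satisfies the covering condition vacuously and every coloring is constant on its
  empty set of pairs, so, as usual for tree forcings, it is not counted as a splitting tree.
\<close>

definition splitting_tree :: "bool list set \<Rightarrow> bool" where
  "splitting_tree T \<longleftrightarrow> is_tree T \<and> T \<noteq> {} \<and>
     (\<forall>t\<in>T. \<exists>a. finite (- a) \<and> covers (tree_restrict T t) a)"

text \<open>
  The topology of the space of two-element subsets of \<open>X\<close>: the quotient topology induced by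
  \<open>(x, y) \<mapsto> {x, y}\<close> from \<open>X \<times> X\<close> without its diagonal.
\<close>

definition off_diagonal :: "'a set \<Rightarrow> ('a \<times> 'a) set" where
  "off_diagonal X = {(x, y). x \<in> X \<and> y \<in> X \<and> x \<noteq> y}"

definition pairs_topology :: "'a::topological_space set \<Rightarrow> 'a set topology" where
  "pairs_topology X = topology (\<lambda>U. U \<subseteq> nsets X 2 \<and>
     openin (top_of_set (off_diagonal X)) {(x, y) \<in> off_diagonal X. {x, y} \<in> U})"

lemma openin_pairs_topology:
  "openin (pairs_topology X) U \<longleftrightarrow> U \<subseteq> nsets X 2 \<and>
     openin (top_of_set (off_diagonal X)) {(x, y) \<in> off_diagonal X. {x, y} \<in> U}"
proof -
  have "istopology (\<lambda>U. U \<subseteq> nsets X 2 \<and>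
     openin (top_of_set (off_diagonal X)) {(x, y) \<in> off_diagonal X. {x, y} \<in> U})"
    (is "istopology (\<lambda>U. _ \<and> openin ?D (?pre U))")
    unfolding istopology_def
  proof (intro conjI allI impI; (elim conjE)?)
    fix U V assume "openin ?D (?pre U)" "openin ?D (?pre V)"
    moreover have "?pre (U \<inter> V) = ?pre U \<inter> ?pre V" by auto
    ultimately show "openin ?D (?pre (U \<inter> V))" by (simp only: openin_Int)
  next
    fix K assume K: "\<forall>U\<in>K. U \<subseteq> nsets X 2 \<and> openin ?D (?pre U)"
    have "?pre (\<Union>K) = \<Union>(?pre ` K)" by auto
    moreover have "openin ?D (\<Union>(?pre ` K))" using K by (intro openin_Union) auto
    ultimately show "openin ?D (?pre (\<Union>K))" by (simp only:)
  qed auto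
  then show ?thesis
    unfolding pairs_topology_def by (simp only: topology_inverse')
qed

lemma quotient_map_pairs_topology:
  "quotient_map (top_of_set (off_diagonal X)) (pairs_topology X) (\<lambda>(x, y). {x, y})"
proof -
  have img: "(\<lambda>(x, y). {x, y}) ` off_diagonal X = nsets X 2"
    unfolding nsets_2_eq off_diagonal_def by blast
  have "{(x, y) \<in> off_diagonal X. {x, y} \<in> nsets X 2} = off_diagonal X"
    using img by blast
  then have "openin (pairs_topology X) (nsets X 2)"
    by (simp add: openin_pairs_topology)
  then have top: "topspace (pairs_topology X) = nsets X 2"
    by (meson openin_pairs_topology openin_subset openin_topspace subset_antisym)
  show ?thesis
    unfolding quotient_map_def top
    using img by (simp add: openin_pairs_topology case_prod_unfold)
qed

end

theory Submission
  imports Defs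
begin

text \<open>
  Thin \<open>T\<close> by fusion to \<open>S\<close>, with levels \<open>k 0 < k 1 < \<dots>\<close>, so that a subtree of \<open>S\<close> covers every
  number beyond \<open>k (Suc j)\<close> only if two of its nodes at level \<open>k (Suc j)\<close> extend the same node at
  level \<open>k j\<close>: for each of the finitely many sets \<open>W\<close> of nodes at level \<open>k (Suc j)\<close> with at most one
  node above each node at level \<open>k j\<close>, pick a large \<open>n\<close> and keep above \<open>W\<close> only branches with value
  0 at \<open>n\<close>. This does not destroy covering, since above each node at level \<open>k j\<close> there is a node
  outside \<open>W\<close>. Hence a splitting subtree of \<open>S\<close> has, for all large \<open>j\<close>, two branches whose first
  difference lies in \<open>[k j, k (Suc j))\<close>. Coloring a pair by the parity of that \<open>j\<close> works.
\<close>

section \<open>Covering as reachability, levels and branches\<close>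

definition reaches :: "bool list set \<Rightarrow> bool list \<Rightarrow> nat \<Rightarrow> bool \<Rightarrow> bool" where
  "reaches T t n i \<longleftrightarrow> (\<exists>s\<in>T. prefix t s \<and> n < length s \<and> s ! n = i)"

definition level :: "bool list set \<Rightarrow> nat \<Rightarrow> bool list set" where
  "level T k = {t \<in> T. length t = k}"

lemma finite_level: "finite (level T k)"
  by (rule finite_subset[OF _ finite_lists_length_eq[of UNIV k]]) (auto simp: level_def)

lemma tree_prefix: "is_tree T \<Longrightarrow> t \<in> T \<Longrightarrow> prefix s t \<Longrightarrow> s \<in> T"
  unfolding is_tree_def by blast

lemma tree_take: "is_tree T \<Longrightarrow> t \<in> T \<Longrightarrow> take n t \<in> T"
  by (meson take_is_prefix tree_prefix)

lemma prefix_nth: "prefix s t \<Longrightarrow> n < length s \<Longrightarrow> t ! n = s ! n"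
  by (auto simp: prefix_def nth_append)

lemma prefix_imp_take_eq: "prefix s t \<Longrightarrow> take (length s) t = s"
  by (auto simp: prefix_def)

lemma prefix_take: "prefix s t \<Longrightarrow> length s \<le> n \<Longrightarrow> prefix s (take n t)"
  by (auto simp: prefix_def)

text \<open>A node below \<open>t\<close> that decides \<open>n\<close> agrees with \<open>t\<close>
  there, so \<open>t\<close> itself can replace it as a witness; only extensions of \<open>t\<close>
  need to be searched.\<close>

lemma covers_restrict_iff_reaches:
  assumes "t \<in> T"
  shows "covers (tree_restrict T t) a \<longleftrightarrow> (\<forall>n\<in>a. \<forall>i. reaches T t n i)"
proof -
  have "(\<exists>s\<in>tree_restrict T t. n < length s \<and> s ! n = i) \<longleftrightarrow> reaches T t n i" for n i
  proof
    assume "\<exists>s\<in>tree_restrict T t. n < length s \<and> s ! n = i"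
    then obtain s where s: "s \<in> T" "prefix s t \<or> prefix t s" "n < length s" "s ! n = i"
      by (auto simp: tree_restrict_def)
    then consider "prefix s t" | "prefix t s" by blast
    then show "reaches T t n i"
    proof cases
      case 1
      then have "n < length t" "t ! n = i"
        using s prefix_length_le[of s t] prefix_nth[of s t n] by auto
      then show ?thesis using assms by (auto simp: reaches_def)
    next
      case 2
      then show ?thesis using s by (auto simp: reaches_def)
    qed
  qed (auto simp: tree_restrict_def reaches_def)
  then show ?thesis unfolding covers_def by auto
qed

text \<open>A cofinite set of naturals contains a tail, and tails are cofinite, so the covered set
  turns into a threshold \<open>N\<close>. The fusion keeps track of these thresholds.\<close>

lemma splitting_tree_iff:
  "splitting_tree T \<longleftrightarrow> is_tree T \<and> T \<noteq> {} \<and> (\<forall>t\<in>T. \<exists>N. \<forall>n\<ge>N. \<forall>i. reaches T t n i)"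
proof -
  have "(\<exists>a. finite (- a) \<and> covers (tree_restrict T t) a) \<longleftrightarrow> (\<exists>N. \<forall>n\<ge>N. \<forall>i. reaches T t n i)"
    if t: "t \<in> T" for t
  proof
    assume "\<exists>a. finite (- a) \<and> covers (tree_restrict T t) a"
    then obtain a where a: "finite (- a)" "\<forall>n\<in>a. \<forall>i. reaches T t n i"
      using covers_restrict_iff_reaches[OF t] by blast
    obtain N where "\<forall>n\<in>- a. n < N" using a(1) unfolding finite_nat_set_iff_bounded by blast
    then have "\<forall>n\<ge>N. n \<in> a" using not_less by blast
    then show "\<exists>N. \<forall>n\<ge>N. \<forall>i. reaches T t n i" using a(2) by blast
  next
    assume "\<exists>N. \<forall>n\<ge>N. \<forall>i. reaches T t n i"
    then obtain N where "\<forall>n\<ge>N. \<forall>i. reaches T t n i" by blast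
    then have "covers (tree_restrict T t) {N..}"
      using covers_restrict_iff_reaches[OF t] by auto
    moreover have "finite (- {N..})" by (simp add: Compl_atLeast)
    ultimately show "\<exists>a. finite (- a) \<and> covers (tree_restrict T t) a" by blast
  qed
  then show ?thesis unfolding splitting_tree_def by auto
qed

lemma splitting_tree_is_tree: "splitting_tree T \<Longrightarrow> is_tree T"
  by (simp add: splitting_tree_def)

lemma splitting_tree_reaches:
  "splitting_tree T \<Longrightarrow> t \<in> T \<Longrightarrow> \<exists>N. \<forall>n\<ge>N. \<forall>i. reaches T t n i"
  by (simp add: splitting_tree_iff)

lemma splitting_tree_Nil: "splitting_tree T \<Longrightarrow> [] \<in> T"
  unfolding splitting_tree_def is_tree_def using Nil_prefix by blast

text \<open>Levels are finite, so one threshold serves a whole level; the sum of the individual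
  thresholds bounds each of them.\<close>

lemma splitting_tree_level_reaches:
  assumes "splitting_tree T"
  shows "\<exists>N. \<forall>t\<in>level T k. \<forall>n\<ge>N. \<forall>i. reaches T t n i"
proof -
  have "\<forall>t\<in>level T k. \<exists>N. \<forall>n\<ge>N. \<forall>i. reaches T t n i"
    using splitting_tree_reaches[OF assms] by (auto simp: level_def)
  then obtain f where f: "\<forall>t\<in>level T k. \<forall>n\<ge>f t. \<forall>i. reaches T t n i"
    using bchoice[of "level T k" "\<lambda>t N. \<forall>n\<ge>N. \<forall>i. reaches T t n i"] by blast
  have "f t \<le> (\<Sum>t\<in>level T k. f t)" if "t \<in> level T k" for t
    using that by (intro member_le_sum finite_level) auto
  then have "reaches T t n i" if "t \<in> level T k" "n \<ge> (\<Sum>t\<in>level T k. f t)" for t n i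
    using f le_trans[of "f t" "\<Sum>t\<in>level T k. f t" n] that by blast
  then show ?thesis by blast
qed

lemma splitting_tree_extend:
  assumes "splitting_tree T" "t \<in> T" "length t \<le> n"
  shows "\<exists>s\<in>level T n. prefix t s"
proof -
  obtain N where N: "\<forall>m\<ge>N. \<forall>i. reaches T t m i"
    using splitting_tree_reaches[OF assms(1,2)] by blast
  then have "reaches T t (max N n) True" by simp
  then obtain s where "s \<in> T" "prefix t s" "n < length s"
    unfolding reaches_def by auto
  then have "take n s \<in> level T n" "prefix t (take n s)"
    using assms tree_take[OF splitting_tree_is_tree] prefix_take by (auto simp: level_def)
  then show ?thesis by blast
qed

text \<open>Splitting trees have no dead ends, so \<open>t\<close> can be extended one bit at a
  time. This leads from nodes to the branches on which colorings are defined.\<close>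

lemma splitting_tree_branch:
  assumes T: "splitting_tree T" and t: "t \<in> T"
  obtains x where "x \<in> branches T" "map x [0..<length t] = t"
proof -
  have "\<exists>f. \<forall>n. (f n \<in> level T (length t + n) \<and> prefix t (f n)) \<and> prefix (f n) (f (Suc n))"
  proof (rule dependent_nat_choice)
    show "\<exists>s. s \<in> level T (length t + 0) \<and> prefix t s" using t by (auto simp: level_def)
  next
    fix s n assume s: "s \<in> level T (length t + n) \<and> prefix t s"
    then show "\<exists>s'. (s' \<in> level T (length t + Suc n) \<and> prefix t s') \<and> prefix s s'"
      using splitting_tree_extend[OF T, of s "length t + Suc n"] prefix_order.trans[of t s]
      by (auto simp: level_def)
  qed
  then obtain f where f: "\<And>n. f n \<in> T" "\<And>n. length (f n) = length t + n"
      "\<And>n. prefix t (f n)" "\<And>n. prefix (f n) (f (Suc n))"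
    unfolding level_def by blast
  have mono: "prefix (f m) (f n)" if "m \<le> n" for m n
    using that by (induction rule: dec_induct) (use f(4) prefix_order.trans in auto)
  \<comment> \<open>\<open>f (Suc n)\<close> has length \<open>length t + Suc n\<close>, so position
    \<open>n\<close> is in range even if \<open>t\<close> is empty.\<close>
  define x where "x n = f (Suc n) ! n" for n
  have x: "x i = f n ! i" if "i < length t + n" for i n
  proof (cases "Suc i \<le> n")
    case True
    then show ?thesis unfolding x_def using prefix_nth[OF mono[OF True], of i] f(2) by simp
  next
    case False
    then show ?thesis unfolding x_def using prefix_nth[OF mono[of n "Suc i"], of i] f(2) that by simp
  qed
  have eq: "map x [0..<n] = take n (f n)" for n
    by (rule nth_equalityI) (auto simp: f(2) x)
  have "x \<in> branches T"
    unfolding branches_def using eq tree_take[OF splitting_tree_is_tree[OF T] f(1)] by simp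
  moreover have "map x [0..<length t] = t"
    unfolding eq using prefix_imp_take_eq[OF f(3)] .
  ultimately show thesis using that by blast
qed

section \<open>A single cut above a set of nodes\<close>

text \<open>Above \<open>W\<close> only nodes that still admit value 0 at \<open>n\<close> remain.
  Each of them extends to a node longer than \<open>n\<close>, and from there on nothing more is
  removed, so the tree still splits. Nodes at level \<open>k\<close> lose nothing that they reach,
  because each has an extension outside \<open>W\<close>.\<close>

lemma cut_splitting_tree:
  assumes T: "splitting_tree T" and kk: "k \<le> k2"
    and W: "W \<subseteq> level T k2"
    and adm: "\<And>p. p \<in> level T k \<Longrightarrow> \<exists>v\<in>level T k2. prefix p v \<and> v \<notin> W"
  obtains T' n where "splitting_tree T'" "T' \<subseteq> T" "\<And>j. j \<le> k2 \<Longrightarrow> level T' j = level T j"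
    "\<And>p m i. p \<in> level T k \<Longrightarrow> reaches T p m i \<Longrightarrow> reaches T' p m i"
    "n \<ge> k2" "\<And>s. s \<in> T' \<Longrightarrow> n < length s \<Longrightarrow> take k2 s \<in> W \<Longrightarrow> \<not> s ! n"
proof -
  obtain l0 where l0: "\<forall>t\<in>level T k2. \<forall>n\<ge>l0. \<forall>i. reaches T t n i"
    using splitting_tree_level_reaches[OF T] by blast
  \<comment> \<open>From \<open>l\<close> on, every node at level \<open>k2\<close> reaches both
    values.\<close>
  define l where "l = max l0 k2"
  have l: "k2 \<le> l" "\<And>t n i. t \<in> level T k2 \<Longrightarrow> n \<ge> l \<Longrightarrow> reaches T t n i"
    using l0 by (auto simp: l_def)
  obtain n0 where n0: "\<forall>t\<in>level T l. \<forall>n\<ge>n0. \<forall>i. reaches T t n i"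
    using splitting_tree_level_reaches[OF T] by blast
  \<comment> \<open>Every node at level \<open>l\<close> reaches value 0 at \<open>n\<close>, so the
    cut spares all nodes of length at most \<open>l\<close>.\<close>
  define n where "n = max n0 l"
  have n: "l \<le> n" "\<And>t i. t \<in> level T l \<Longrightarrow> reaches T t n i"
    using n0 by (auto simp: n_def)
  \<comment> \<open>Asking for an extension with value 0 at \<open>n\<close>, instead of \<open>\<not> s ! n\<close>, keeps \<open>T'\<close> free of dead ends.\<close>
  define T' where "T' = {s \<in> T. (\<exists>v\<in>W. prefix v s) \<longrightarrow> reaches T s n False}"
  have tree: "is_tree T" using T by (rule splitting_tree_is_tree)
  have lenW: "length v = k2" if "v \<in> W" for v using W that by (auto simp: level_def)
  have sub: "T' \<subseteq> T" by (auto simp: T'_def)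
  have tree': "is_tree T'"
    unfolding is_tree_def
  proof (intro ballI allI impI)
    fix t s assume ts: "t \<in> T'" "prefix s t"
    have "s \<in> T" using tree_prefix[OF tree, of t s] ts sub by blast
    moreover have "reaches T s n False" if "v \<in> W" "prefix v s" for v
    proof -
      have "reaches T t n False"
        using ts that prefix_order.trans[of v s t] by (auto simp: T'_def)
      then show ?thesis
        unfolding reaches_def using prefix_order.trans[OF ts(2)] by blast
    qed
    ultimately show "s \<in> T'" by (auto simp: T'_def)
  qed
  have short: "s \<in> T'" if s: "s \<in> T" "length s \<le> l" for s
  proof -
    obtain u where "u \<in> level T l" "prefix s u" using splitting_tree_extend[OF T s] by blast
    then have "reaches T s n False"
      using n(2)[of u False] prefix_order.trans[of s u] unfolding reaches_def by blast
    then show ?thesis using s by (simp add: T'_def)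
  qed
  have uncut: "s \<in> T'" if "s \<in> T" "v \<in> level T k2" "v \<notin> W" "prefix v s" for s v
  proof -
    have "\<not> prefix w s" if "w \<in> W" for w
    proof
      assume "prefix w s"
      then have "w = v"
        using lenW[OF that] \<open>v \<in> level T k2\<close> prefix_imp_take_eq[of w s] prefix_imp_take_eq[OF \<open>prefix v s\<close>]
        by (simp add: level_def)
      then show False using that \<open>v \<notin> W\<close> by simp
    qed
    then show ?thesis using \<open>s \<in> T\<close> by (auto simp: T'_def)
  qed
  \<comment> \<open>A node of \<open>T'\<close> longer than \<open>n\<close> has its value at
    \<open>n\<close> fixed, to 0 if it lies above \<open>W\<close>; hence all its extensions in
    \<open>T\<close> survive.\<close>
  have above: "s \<in> T'" if "t \<in> T'" "n < length t" "s \<in> T" "prefix t s" for s t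
  proof -
    have "reaches T s n False" if "v \<in> W" "prefix v s" for v
    proof -
      have "prefix v t" using prefix_length_prefix[of v s t] that \<open>prefix t s\<close> lenW[of v] l(1) n(1) \<open>n < length t\<close>
        by simp
      then have "\<not> t ! n" using \<open>t \<in> T'\<close> \<open>v \<in> W\<close> \<open>n < length t\<close>
        by (auto simp: T'_def reaches_def dest: prefix_nth)
      then show ?thesis
        unfolding reaches_def
        using \<open>s \<in> T\<close> \<open>n < length t\<close> prefix_length_le[OF \<open>prefix t s\<close>] prefix_nth[OF \<open>prefix t s\<close>, of n]
        by (intro bexI[of _ s]) auto
    qed
    then show ?thesis using \<open>s \<in> T\<close> by (auto simp: T'_def)
  qed
  have ext: "\<exists>s\<in>T'. prefix t s \<and> n < length s" if t: "t \<in> T'" for t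
  proof (cases "\<exists>v\<in>W. prefix v t")
    case True
    then obtain s where s: "s \<in> T" "prefix t s" "n < length s" "\<not> s ! n"
      using t by (auto simp: T'_def reaches_def)
    then have "s \<in> T'" by (auto simp: T'_def reaches_def)
    then show ?thesis using s by blast
  next
    case False
    show ?thesis
    proof (cases "length t \<le> k2")
      case True
      \<comment> \<open>It is still open whether an extension of \<open>t\<close> enters
        \<open>W\<close>; one with value 0 at \<open>n\<close> survives in either case.\<close>
      then have "\<exists>u\<in>level T l. prefix t u"
        using splitting_tree_extend[OF T, of t l] t sub l(1) by auto
      then obtain u where u: "u \<in> level T l" "prefix t u" by blast
      then obtain s where "s \<in> T" "prefix u s" "n < length s" "\<not> s ! n"
        using n(2)[of u False] by (auto simp: reaches_def)
      then have "s \<in> T'" by (auto simp: T'_def reaches_def)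
      then show ?thesis using \<open>prefix u s\<close> \<open>n < length s\<close> prefix_order.trans[OF u(2)] by blast
    next
      case long: False
      have "take k2 t \<in> level T k2" "take k2 t \<notin> W"
        using False long t sub tree_take[OF tree] take_is_prefix[of k2 t] by (auto simp: level_def)
      obtain s where "s \<in> level T (Suc (n + length t))" "prefix t s"
        using splitting_tree_extend[OF T, of t "Suc (n + length t)"] t sub by auto
      then have "s \<in> T'"
        using uncut[of s "take k2 t"] \<open>take k2 t \<in> level T k2\<close> \<open>take k2 t \<notin> W\<close>
          prefix_order.trans[OF take_is_prefix, of t s k2]
        by (auto simp: level_def)
      then show ?thesis
        using \<open>s \<in> level T (Suc (n + length t))\<close> \<open>prefix t s\<close> by (auto simp: level_def)
    qed
  qed
  have "\<exists>N. \<forall>m\<ge>N. \<forall>i. reaches T' t m i" if t: "t \<in> T'" for t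
  proof -
    obtain u where u: "u \<in> T'" "prefix t u" "n < length u" using ext[OF t] by blast
    obtain N where N: "\<forall>m\<ge>N. \<forall>i. reaches T u m i"
      using splitting_tree_reaches[OF T] u(1) sub by blast
    have "reaches T' t m i" if "m \<ge> N" for m i
      using N that above[OF u(1,3)] u(2) prefix_order.trans[OF u(2)] unfolding reaches_def by blast
    then show ?thesis by blast
  qed
  moreover have "[] \<in> T'" using short splitting_tree_Nil[OF T] by simp
  ultimately have "splitting_tree T'" using tree' by (auto simp: splitting_tree_iff)
  moreover have "level T' j = level T j" if "j \<le> k2" for j
    using short sub that l(1) by (auto simp: level_def)
  \<comment> \<open>For \<open>m < l\<close> the witness is truncated to length \<open>l\<close>,
    where nothing was cut; for larger \<open>m\<close> a new witness is taken above a node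
    \<open>v\<close> outside \<open>W\<close>.\<close>
  moreover have "reaches T' p m i" if p: "p \<in> level T k" and r: "reaches T p m i" for p m i
  proof (cases "m < l")
    case True
    obtain s where s: "s \<in> T" "prefix p s" "m < length s" "s ! m = i"
      using r by (auto simp: reaches_def)
    have "take l s \<in> T'" using short tree_take[OF tree s(1)] by simp
    moreover have "prefix p (take l s)"
      using s(2) p kk l(1) by (intro prefix_take) (auto simp: level_def)
    ultimately show ?thesis using s True unfolding reaches_def by (intro bexI[of _ "take l s"]) auto
  next
    case False
    obtain v where v: "v \<in> level T k2" "prefix p v" "v \<notin> W" using adm[OF p] by blast
    obtain s where "s \<in> T" "prefix v s" "m < length s" "s ! m = i"
      using l(2)[OF v(1), of m i] False by (auto simp: reaches_def)
    then show ?thesis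
      using uncut[OF _ v(1,3)] prefix_order.trans[OF v(2)] unfolding reaches_def by blast
  qed
  moreover have "\<not> s ! n" if "s \<in> T'" "n < length s" "take k2 s \<in> W" for s
  proof -
    have "reaches T s n False" using that take_is_prefix[of k2 s] by (auto simp: T'_def)
    then show ?thesis using that(2) by (auto simp: reaches_def dest: prefix_nth)
  qed
  moreover have "n \<ge> k2" using l n by simp
  ultimately show thesis by (intro that[of T' n] sub)
qed

section \<open>Thinning for all sparse sets at one level\<close>

text \<open>All nodes at level \<open>k\<close> reach both values at one common \<open>n\<close>,
  which gives two extensions of length \<open>Suc n\<close>. A set with at most one node above each
  \<open>p\<close> must then miss one of them, as a cut requires.\<close>

lemma splitting_tree_splits_at_level:
  assumes T: "splitting_tree T"
  obtains k2 where "k < k2"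
    "\<And>p. p \<in> level T k \<Longrightarrow> \<exists>v\<in>level T k2. \<exists>v'\<in>level T k2. prefix p v \<and> prefix p v' \<and> v \<noteq> v'"
proof -
  obtain N where N: "\<forall>t\<in>level T k. \<forall>n\<ge>N. \<forall>i. reaches T t n i"
    using splitting_tree_level_reaches[OF T] by blast
  define n where "n = max N k"
  have "\<exists>v\<in>level T (Suc n). prefix p v \<and> v ! n = i" if p: "p \<in> level T k" for p i
  proof -
    have "reaches T p n i" using N p by (simp add: n_def)
    then obtain s where s: "s \<in> T" "prefix p s" "n < length s" "s ! n = i"
      by (auto simp: reaches_def)
    have "length p \<le> Suc n" using p by (auto simp: level_def n_def)
    then have "prefix p (take (Suc n) s)" using s(2) by (rule prefix_take[rotated])
    moreover have "take (Suc n) s \<in> level T (Suc n)"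
      using tree_take[OF splitting_tree_is_tree[OF T] s(1)] s(3) by (simp add: level_def)
    moreover have "take (Suc n) s ! n = i" using s by simp
    ultimately show ?thesis by blast
  qed
  then have "\<exists>v\<in>level T (Suc n). \<exists>v'\<in>level T (Suc n). prefix p v \<and> prefix p v' \<and> v \<noteq> v'"
    if "p \<in> level T k" for p using that by metis
  moreover have "k < Suc n" by (simp add: n_def)
  ultimately show thesis using that by blast
qed

text \<open>The last clause preserves thresholds, not merely the splitting property: along
  infinitely many steps thresholds could otherwise grow without bound, and the intersection could
  fail to split.\<close>

definition thinning :: "nat \<Rightarrow> bool list set \<Rightarrow> nat \<Rightarrow> bool list set \<Rightarrow> bool" where
  "thinning k T k2 T' \<longleftrightarrow> splitting_tree T' \<and> T' \<subseteq> T \<and> (\<forall>j\<le>k2. level T' j = level T j) \<and>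
     (\<forall>p\<in>level T k. \<forall>m i. reaches T p m i \<longrightarrow> reaches T' p m i)"

text \<open>A subtree of \<open>T\<close> whose nodes at level \<open>k\<close> all lie in
  \<open>W\<close> cannot take value 1 at the witness \<open>n\<close>.\<close>

definition avoids :: "bool list set \<Rightarrow> nat \<Rightarrow> bool list set \<Rightarrow> bool" where
  "avoids T k W \<longleftrightarrow> (\<exists>n\<ge>k. \<forall>s\<in>T. n < length s \<longrightarrow> take k s \<in> W \<longrightarrow> \<not> s ! n)"

lemma avoids_mono: "avoids T k W \<Longrightarrow> S \<subseteq> T \<Longrightarrow> avoids S k W"
  unfolding avoids_def by blast

text \<open>Injectivity of \<open>take k\<close> on \<open>W\<close> says that at most one node of
  \<open>W\<close> lies above each node at level \<open>k\<close>. There are finitely many such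
  \<open>W\<close>, and they are cut one after another: no cut changes the levels up to
  \<open>k2\<close>, and earlier avoidance passes to subtrees.\<close>

lemma ex_thinning_avoids:
  assumes T: "splitting_tree T"
  shows "\<exists>k2>k. \<exists>T'. thinning k T k2 T' \<and>
    (\<forall>W\<subseteq>level T k2. inj_on (take k) W \<longrightarrow> avoids T' k2 W)"
proof -
  obtain k2 where k2: "k < k2"
    "\<And>p. p \<in> level T k \<Longrightarrow> \<exists>v\<in>level T k2. \<exists>v'\<in>level T k2. prefix p v \<and> prefix p v' \<and> v \<noteq> v'"
    using splitting_tree_splits_at_level[OF T] by blast
  let ?F = "{W. W \<subseteq> level T k2 \<and> inj_on (take k) W}"
  have adm: "\<exists>v\<in>level T k2. prefix p v \<and> v \<notin> W" if W: "W \<in> ?F" and p: "p \<in> level T k" for W p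
  proof -
    obtain v v' where v: "v \<in> level T k2" "v' \<in> level T k2" "prefix p v" "prefix p v'" "v \<noteq> v'"
      using k2(2)[OF p] by blast
    have "take k v = take k v'"
      using prefix_imp_take_eq[OF v(3)] prefix_imp_take_eq[OF v(4)] p by (auto simp: level_def)
    then have "v \<notin> W \<or> v' \<notin> W" using W v(5) by (auto dest: inj_onD)
    then show ?thesis using v by blast
  qed
  have "finite ?F" by (rule finite_subset[of _ "Pow (level T k2)"]) (auto simp: finite_level)
  moreover have "\<exists>T'. thinning k T k2 T' \<and> (\<forall>W\<in>G. avoids T' k2 W)" if "finite G" "G \<subseteq> ?F" for G
    using that
  proof (induction G rule: finite_induct)
    case empty
    show ?case by (rule exI[of _ T]) (auto simp: thinning_def T)
  next
    case (insert W G)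
    then obtain T1 where T1: "thinning k T k2 T1" "\<forall>W\<in>G. avoids T1 k2 W" by auto
    have W: "W \<in> ?F" using insert.prems by auto
    have lev: "level T1 j = level T j" if "j \<le> k2" for j using T1(1) that by (simp add: thinning_def)
    have h1: "splitting_tree T1" using T1 by (simp add: thinning_def)
    have h2: "k \<le> k2" "W \<subseteq> level T1 k2" using k2(1) W lev by auto
    have h3: "\<exists>v\<in>level T1 k2. prefix p v \<and> v \<notin> W" if "p \<in> level T1 k" for p
      using adm[OF W] that k2(1) lev by simp
    obtain T2 n where T2: "splitting_tree T2" "T2 \<subseteq> T1"
      "\<And>j. j \<le> k2 \<Longrightarrow> level T2 j = level T1 j"
      "\<And>p m i. p \<in> level T1 k \<Longrightarrow> reaches T1 p m i \<Longrightarrow> reaches T2 p m i"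
      "n \<ge> k2" "\<And>s. s \<in> T2 \<Longrightarrow> n < length s \<Longrightarrow> take k2 s \<in> W \<Longrightarrow> \<not> s ! n"
      by (rule cut_splitting_tree[OF h1 h2 h3]) (assumption, rule that)
    have "thinning k T k2 T2"
      using T1(1) T2(1-4) lev k2(1) by (auto simp: thinning_def)
    moreover have "avoids T2 k2 W" using T2(5,6) by (auto simp: avoids_def)
    ultimately show ?case using T1(2) avoids_mono T2(2) by blast
  qed
  ultimately obtain T' where "thinning k T k2 T'" "\<forall>W\<in>?F. avoids T' k2 W" by blast
  then show ?thesis using k2(1) by blast
qed

section \<open>The fusion\<close>

text \<open>\<open>S\<close> is the intersection of successive thinnings \<open>U n\<close>. Levels
  up to \<open>k (Suc n)\<close> are final from stage \<open>n\<close> on, and a threshold found at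
  stage \<open>j\<close> for a node at level \<open>k j\<close> stays valid at all later stages and
  in \<open>S\<close>.\<close>

lemma fusion:
  assumes T: "splitting_tree T"
  obtains S :: "bool list set" and k :: "nat \<Rightarrow> nat" where
    "splitting_tree S" "S \<subseteq> T" "strict_mono k"
    "\<And>j W. W \<subseteq> level S (k (Suc j)) \<Longrightarrow> inj_on (take (k j)) W \<Longrightarrow> avoids S (k (Suc j)) W"
proof -
  define P :: "nat \<Rightarrow> bool list set \<times> nat \<Rightarrow> bool" where
    "P n a \<longleftrightarrow> splitting_tree (fst a) \<and> fst a \<subseteq> T" for n :: nat and a
  define Q :: "nat \<Rightarrow> bool list set \<times> nat \<Rightarrow> bool list set \<times> nat \<Rightarrow> bool" where
    "Q n a b \<longleftrightarrow> snd a < snd b \<and> thinning (snd a) (fst a) (snd b) (fst b) \<and>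
      (\<forall>W\<subseteq>level (fst a) (snd b). inj_on (take (snd a)) W \<longrightarrow> avoids (fst b) (snd b) W)" for n a b
  have "\<exists>f. \<forall>n. P n (f n) \<and> Q n (f n) (f (Suc n))"
  proof (rule dependent_nat_choice)
    show "\<exists>a. P 0 a" by (rule exI[of _ "(T, 0)"]) (auto simp: P_def T)
  next
    fix a n assume a: "P n a"
    then obtain k2 T' where "snd a < k2" "thinning (snd a) (fst a) k2 T'"
      "\<forall>W\<subseteq>level (fst a) k2. inj_on (take (snd a)) W \<longrightarrow> avoids T' k2 W"
      using ex_thinning_avoids[of "fst a" "snd a"] unfolding P_def by blast
    then show "\<exists>b. P (Suc n) b \<and> Q n a b"
      using a by (intro exI[of _ "(T', k2)"]) (auto simp: P_def Q_def thinning_def)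
  qed
  then obtain f where f: "\<And>n. P n (f n)" "\<And>n. Q n (f n) (f (Suc n))" by blast
  define U where "U n = fst (f n)" for n
  define k where "k n = snd (f n)" for n
  define S where "S = (\<Inter>n. U n)"
  have U: "splitting_tree (U n)" "U n \<subseteq> T" for n
    using f(1)[of n] by (auto simp: P_def U_def)
  have k: "strict_mono k"
    using f(2) by (simp add: strict_mono_Suc_iff Q_def k_def)
  have thin: "thinning (k n) (U n) (k (Suc n)) (U (Suc n))" for n
    using f(2)[of n] by (auto simp: Q_def k_def U_def)
  have mono: "U n \<subseteq> U m" if "m \<le> n" for m n
  proof (rule lift_Suc_antimono_le[OF _ that])
    show "U (Suc n) \<subseteq> U n" for n using thin[of n] by (simp add: thinning_def)
  qed
  have level_le: "level (U m) i = level (U n) i" if "m \<le> n" "i \<le> k (Suc m)" for m n i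
    using that(1)
  proof (induction rule: dec_induct)
    case (step n)
    have "k (Suc m) \<le> k (Suc n)" using k step(1) by (simp add: strict_mono_less_eq)
    then show ?case using step.IH thin[of n] that(2) by (simp add: thinning_def)
  qed simp
  have level_S: "level S i = level (U n) i" if "i \<le> k (Suc n)" for i n
  proof
    show "level S i \<subseteq> level (U n) i" by (auto simp: S_def level_def)
    show "level (U n) i \<subseteq> level S i"
    proof
      fix t assume t: "t \<in> level (U n) i"
      have "t \<in> U m" for m
      proof (cases "n \<le> m")
        case True
        then have "t \<in> level (U m) i" using t level_le[OF True that] by simp
        then show ?thesis by (simp add: level_def)
      next
        case False
        then show ?thesis using t mono[of m n] by (auto simp: level_def)
      qed
      then show "t \<in> level S i" using t by (simp add: S_def level_def)
    qed
  qed
  have S_sub: "S \<subseteq> U n" for n by (auto simp: S_def)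
  have id_le: "n \<le> k n" for n using k by (rule strict_mono_imp_increasing)
  have tree: "is_tree S"
    unfolding is_tree_def
  proof (intro ballI allI impI)
    fix t s assume t: "t \<in> S" "prefix s t"
    have "s \<in> U n" for n
      by (rule tree_prefix[OF splitting_tree_is_tree[OF U(1)] _ t(2)]) (use t(1) S_sub in blast)
    then show "s \<in> S" by (simp add: S_def)
  qed
  have reach_top: "\<exists>N. \<forall>n\<ge>N. \<forall>i. reaches S t n i" if t: "t \<in> level S (k j)" for t j
  proof -
    have "t \<in> U j" using t S_sub[of j] by (auto simp: level_def)
    then obtain N where N: "\<forall>n\<ge>N. \<forall>i. reaches (U j) t n i"
      using splitting_tree_reaches[OF U(1)] by blast
    \<comment> \<open>Thinning protects only nodes at level \<open>k (j + d)\<close>, so it is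
      applied to the truncation \<open>?p\<close> of the witness; a witness too short for this
      already lies in \<open>S\<close>.\<close>
    have later: "reaches (U (j + d)) t n i" if "n \<ge> N" for d n i
    proof (induction d)
      case 0
      then show ?case using N that by simp
    next
      case (Suc d)
      obtain s where s: "s \<in> U (j + d)" "prefix t s" "n < length s" "s ! n = i"
        using Suc by (auto simp: reaches_def)
      have "length t \<le> k (j + d)" using t k by (simp add: level_def strict_mono_less_eq)
      show ?case
      proof (cases "length s \<le> k (j + d)")
        case True
        then have "s \<in> level S (length s)"
          using s(1) level_S[of "length s" "j + d"] strict_mono_leD[OF k, of "j + d" "Suc (j + d)"]
          by (simp add: level_def)
        then show ?thesis using s S_sub[of "j + Suc d"] by (auto simp: level_def reaches_def)
      next
        case False
        let ?p = "take (k (j + d)) s"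
        have p: "?p \<in> level (U (j + d)) (k (j + d))"
          using False tree_take[OF splitting_tree_is_tree[OF U(1)] s(1)] by (simp add: level_def)
        have "reaches (U (j + d)) ?p n i"
          using s take_is_prefix by (auto simp: reaches_def)
        then have "reaches (U (j + Suc d)) ?p n i"
          using thin[of "j + d"] p by (simp add: thinning_def)
        moreover have "prefix t ?p"
          using s(2) \<open>length t \<le> k (j + d)\<close> by (rule prefix_take)
        ultimately show ?thesis
          unfolding reaches_def using prefix_order.trans[of t ?p] by blast
      qed
    qed
    have "reaches S t n i" if n: "n \<ge> N" for n i
    proof -
      \<comment> \<open>Since \<open>k m\<close> is at least \<open>m\<close>, hence above
        \<open>n\<close>, truncating to length \<open>k m\<close> keeps position \<open>n\<close>,
        and level \<open>k m\<close> is final at stage \<open>m\<close>. The summand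
        \<open>j\<close> ensures that \<open>t\<close> is not cut off.\<close>
      define m where "m = j + Suc n"
      obtain s where s: "s \<in> U m" "prefix t s" "n < length s" "s ! n = i"
        using later[OF n, of "Suc n" i] by (auto simp: reaches_def m_def)
      have m: "n < k m" "k j \<le> k m" "k m \<le> k (Suc m)"
        using id_le[of m] k by (auto simp: m_def strict_mono_less_eq)
      have "take (k m) s \<in> level (U m) (length (take (k m) s))"
        using tree_take[OF splitting_tree_is_tree[OF U(1)] s(1)] by (simp add: level_def)
      then have "take (k m) s \<in> level S (length (take (k m) s))"
        using level_S[of "length (take (k m) s)" m] m(3) by simp
      then have "take (k m) s \<in> S" by (simp add: level_def)
      moreover have "prefix t (take (k m) s)"
        using s(2) t m(2) by (intro prefix_take) (auto simp: level_def)
      ultimately show ?thesis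
        unfolding reaches_def using s m(1) by (intro bexI[of _ "take (k m) s"]) auto
    qed
    then show ?thesis by blast
  qed
  have "\<exists>N. \<forall>n\<ge>N. \<forall>i. reaches S t n i" if t: "t \<in> S" for t
  proof -
    \<comment> \<open>With this \<open>j\<close>, \<open>t\<close> has length at most
      \<open>k j\<close> and extends to a node at level \<open>k j\<close>, where
      \<open>reach_top\<close> applies.\<close>
    define j where "j = length t"
    have "t \<in> U j" using t S_sub by blast
    then obtain u where u: "u \<in> level (U j) (k j)" "prefix t u"
      using splitting_tree_extend[OF U(1), of t j "k j"] id_le[of j] by (auto simp: j_def)
    have "k j \<le> k (Suc j)" using k by (simp add: strict_mono_less_eq)
    then have "u \<in> level S (k j)" using u level_S by simp
    then obtain N where "\<forall>n\<ge>N. \<forall>i. reaches S u n i" using reach_top by blast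
    then show ?thesis unfolding reaches_def using prefix_order.trans[OF u(2)] by blast
  qed
  moreover have "[] \<in> S" using splitting_tree_Nil[OF U(1)] by (simp add: S_def)
  ultimately have "splitting_tree S" using tree by (auto simp: splitting_tree_iff)
  moreover have "avoids S (k (Suc j)) W"
    if "W \<subseteq> level S (k (Suc j))" "inj_on (take (k j)) W" for j W
  proof -
    have "avoids (U (Suc j)) (k (Suc j)) W"
      using f(2)[of j] that level_S[of "k (Suc j)" j] by (auto simp: Q_def k_def U_def)
    then show ?thesis using avoids_mono S_sub by blast
  qed
  moreover have "S \<subseteq> T" using U(2)[of 0] S_sub[of 0] by simp
  ultimately show thesis using that[of S k] k by blast
qed

section \<open>First differences and continuous colorings\<close>

text \<open>Defined on sets, so that it is a function of the unordered pair.\<close>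

definition first_diff :: "(nat \<Rightarrow> bool) set \<Rightarrow> nat" where
  "first_diff X = (LEAST n. \<exists>x\<in>X. \<exists>y\<in>X. x n \<noteq> y n)"

lemma first_diff_pair: "first_diff {x, y} = (LEAST n. x n \<noteq> y n)"
proof -
  have "(\<exists>u\<in>{x, y}. \<exists>v\<in>{x, y}. u n \<noteq> v n) \<longleftrightarrow> x n \<noteq> y n" for n
    by (simp only: bex_simps ex_simps) blast
  then show ?thesis by (simp only: first_diff_def)
qed

lemma first_diff_eqI:
  assumes "x d \<noteq> y d" "\<And>i. i < d \<Longrightarrow> x i = y i"
  shows "first_diff {x, y} = d"
  unfolding first_diff_pair using assms by (intro Least_equality) (auto simp: not_less[symmetric])

lemma first_diff_props:
  assumes "x \<noteq> y"
  shows "x (first_diff {x, y}) \<noteq> y (first_diff {x, y})" "i < first_diff {x, y} \<Longrightarrow> x i = y i"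
proof -
  obtain n where "x n \<noteq> y n" using assms unfolding fun_eq_iff by blast
  then show "x (first_diff {x, y}) \<noteq> y (first_diff {x, y})"
    unfolding first_diff_pair by (rule LeastI)
  show "x i = y i" if "i < first_diff {x, y}"
    using not_less_Least[OF that[unfolded first_diff_pair]] by simp
qed

lemma open_cylinder: "open {x :: nat \<Rightarrow> bool. \<forall>i\<le>d. x i = z i}"
proof -
  have "open ((\<lambda>x :: nat \<Rightarrow> bool. x i) -` {z i})" for i
    by (rule open_vimage) (auto intro: open_discrete continuous_on_product_coordinates)
  then have "open (\<Inter>i\<in>{..d}. (\<lambda>x :: nat \<Rightarrow> bool. x i) -` {z i})" by (intro open_INT) auto
  moreover have "(\<Inter>i\<in>{..d}. (\<lambda>x :: nat \<Rightarrow> bool. x i) -` {z i}) = {x. \<forall>i\<le>d. x i = z i}" by auto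
  ultimately show ?thesis by simp
qed

text \<open>The first difference is locally constant: if \<open>u\<close> agrees with
  \<open>x\<close>, and \<open>v\<close> with \<open>y\<close>, up to and including position
  \<open>d\<close>, then \<open>u\<close> and \<open>v\<close> first differ at \<open>d\<close> as
  well. Continuity then descends along the quotient map.\<close>

lemma continuous_map_first_diff:
  fixes X :: "(nat \<Rightarrow> bool) set" and g :: "nat \<Rightarrow> 'b"
  shows "continuous_map (pairs_topology X) (discrete_topology UNIV) (\<lambda>p. g (first_diff p))"
proof -
  let ?D = "off_diagonal X" and ?h = "\<lambda>(x, y). g (first_diff {x, y})"
  have "openin (top_of_set ?D) {p \<in> ?D. ?h p \<in> V}" for V
  proof (subst openin_subopen, intro ballI)
    fix p assume p: "p \<in> {p \<in> ?D. ?h p \<in> V}"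
    obtain x y where xy: "p = (x, y)" by fastforce
    define d where "d = first_diff {x, y}"
    define C where "C = {u. \<forall>i\<le>d. u i = x i} \<times> {v. \<forall>i\<le>d. v i = y i}"
    have "x \<noteq> y" using p xy by (auto simp: off_diagonal_def)
    then have d: "x d \<noteq> y d" "\<And>i. i < d \<Longrightarrow> x i = y i"
      using first_diff_props[of x y] by (auto simp: d_def)
    have "first_diff {u, v} = d" if "(u, v) \<in> C" for u v
      using that d by (intro first_diff_eqI) (auto simp: C_def)
    then have "?D \<inter> C \<subseteq> {p \<in> ?D. ?h p \<in> V}" using p xy by (auto simp: d_def)
    moreover have "open C" unfolding C_def by (intro open_Times open_cylinder)
    then have "openin (top_of_set ?D) (?D \<inter> C)" by (rule openin_open_Int)
    moreover have "p \<in> ?D \<inter> C" using p xy by (auto simp: C_def)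
    ultimately show "\<exists>T. openin (top_of_set ?D) T \<and> p \<in> T \<and> T \<subseteq> {p \<in> ?D. ?h p \<in> V}" by blast
  qed
  then have "continuous_map (top_of_set ?D) (discrete_topology UNIV) ?h"
    by (simp add: continuous_map)
  moreover have "?h = (\<lambda>p. g (first_diff p)) \<circ> (\<lambda>(x, y). {x, y})" by auto
  ultimately show ?thesis
    using continuous_compose_quotient_map_eq[OF quotient_map_pairs_topology[of X]] by metis
qed

section \<open>Splitting subtrees against the coloring\<close>

text \<open>Branches through \<open>v\<close> and \<open>w\<close> first differ where these two
  nodes do: below \<open>l\<close> because the nodes are distinct, and not below \<open>k\<close>
  because they agree there.\<close>

lemma splitting_tree_branches_first_diff:
  assumes R: "splitting_tree R" and v: "v \<in> level R l" "w \<in> level R l" "v \<noteq> w"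
    and eq: "take k v = take k w"
  obtains x y where "{x, y} \<in> nsets (branches R) 2" "k \<le> first_diff {x, y}" "first_diff {x, y} < l"
proof -
  have len: "v \<in> R" "w \<in> R" "length v = l" "length w = l" using v by (auto simp: level_def)
  obtain x where x: "x \<in> branches R" "map x [0..<l] = v"
    using splitting_tree_branch[OF R len(1)] len(3) by blast
  obtain y where y: "y \<in> branches R" "map y [0..<l] = w"
    using splitting_tree_branch[OF R len(2)] len(4) by blast
  have nth: "x i = v ! i" "y i = w ! i" if "i < l" for i
    using x(2) y(2) that by auto
  obtain n where n: "n < l" "v ! n \<noteq> w ! n"
    using v(3) len(3,4) nth_equalityI[of v w] by auto
  have "x \<noteq> y" using n nth by auto
  then have d: "x (first_diff {x, y}) \<noteq> y (first_diff {x, y})"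
      "\<And>i. i < first_diff {x, y} \<Longrightarrow> x i = y i"
    using first_diff_props[of x y] by auto
  have "\<not> n < first_diff {x, y}" using d(2)[of n] n nth by auto
  then have "first_diff {x, y} < l" using n(1) by simp
  moreover have "k \<le> first_diff {x, y}"
  proof (rule ccontr)
    assume "\<not> k \<le> first_diff {x, y}"
    then have "v ! first_diff {x, y} = w ! first_diff {x, y}"
      using arg_cong[OF eq, of "\<lambda>u. u ! first_diff {x, y}"] by simp
    then show False using d(1) nth \<open>first_diff {x, y} < l\<close> by simp
  qed
  moreover have "{x, y} \<in> nsets (branches R) 2"
    using x(1) y(1) \<open>x \<noteq> y\<close> by (auto simp: nsets_2_eq)
  ultimately show thesis using that by blast
qed

theorem theorem3p2:
  fixes T :: "bool list set"
  assumes "splitting_tree T"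
  shows "\<exists>S. splitting_tree S \<and> S \<subseteq> T \<and>
    (\<exists>c :: (nat \<Rightarrow> bool) set \<Rightarrow> bool.
       continuous_map (pairs_topology (branches S)) (discrete_topology UNIV) c \<and>
       \<not> (\<exists>R. splitting_tree R \<and> R \<subseteq> S \<and> c constant_on nsets (branches R) 2))"
proof -
  obtain S k where S: "splitting_tree S" "S \<subseteq> T" and k: "strict_mono (k :: nat \<Rightarrow> nat)"
    and avoid: "\<And>j W. W \<subseteq> level S (k (Suc j)) \<Longrightarrow> inj_on (take (k j)) W \<Longrightarrow> avoids S (k (Suc j)) W"
    using fusion[OF assms] by blast
  \<comment> \<open>The index \<open>j\<close> of the interval \<open>[k j, k (Suc j))\<close>
    containing \<open>d\<close>; numbers below \<open>k 0\<close> also get stage 0.\<close>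
  define stage where "stage d = (LEAST j. d < k (Suc j))" for d
  define c :: "(nat \<Rightarrow> bool) set \<Rightarrow> bool" where "c p = even (stage (first_diff p))" for p
  have stage: "stage d = j" if "k j \<le> d" "d < k (Suc j)" for d j
    unfolding stage_def
  proof (rule Least_equality)
    fix i assume "d < k (Suc i)"
    then have "k j < k (Suc i)" using that(1) by simp
    then show "j \<le> i" using k by (simp add: strict_mono_less)
  qed (rule that(2))
  have "\<not> c constant_on nsets (branches R) 2" if R: "splitting_tree R" "R \<subseteq> S" for R
  proof
    assume "c constant_on nsets (branches R) 2"
    then obtain b where b: "\<And>p. p \<in> nsets (branches R) 2 \<Longrightarrow> c p = b"
      by (auto simp: constant_on_def)
    obtain N where N: "\<forall>n\<ge>N. \<forall>i. reaches R [] n i"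
      using splitting_tree_reaches[OF R(1) splitting_tree_Nil[OF R(1)]] by blast
    \<comment> \<open>At least \<open>N\<close>, and of the parity for which pairs of stage
      \<open>j\<close> have the color other than \<open>b\<close>.\<close>
    define j where "j = (if b then 2 * N + 1 else 2 * N)"
    have j: "N \<le> j" "even j \<noteq> b" by (auto simp: j_def)
    let ?W = "level R (k (Suc j))"
    \<comment> \<open>Two nodes with the same truncation would yield a pair of branches of stage
      \<open>j\<close>, hence of the wrong color.\<close>
    have "inj_on (take (k j)) ?W"
    proof (rule inj_onI, rule ccontr)
      fix v w assume vw: "v \<in> ?W" "w \<in> ?W" "take (k j) v = take (k j) w" "v \<noteq> w"
      obtain x y where xy: "{x, y} \<in> nsets (branches R) 2"
          "k j \<le> first_diff {x, y}" "first_diff {x, y} < k (Suc j)"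
        using splitting_tree_branches_first_diff[OF R(1) vw(1,2,4,3)] .
      show False using b[OF xy(1)] stage[OF xy(2,3)] j(2) by (simp add: c_def)
    qed
    moreover have "?W \<subseteq> level S (k (Suc j))" using R(2) by (auto simp: level_def)
    ultimately obtain n where n: "n \<ge> k (Suc j)"
        "\<forall>s\<in>S. n < length s \<longrightarrow> take (k (Suc j)) s \<in> ?W \<longrightarrow> \<not> s ! n"
      using avoid[of ?W j] unfolding avoids_def by blast
    \<comment> \<open>As \<open>n\<close> is at least \<open>k (Suc j)\<close>, it is past the
      threshold \<open>N\<close>, so \<open>R\<close> takes value 1 at \<open>n\<close>, which
      avoidance of the full level \<open>?W\<close> of \<open>R\<close> forbids.\<close>
    have "N \<le> n" using n(1) j(1) strict_mono_imp_increasing[OF k, of "Suc j"] by simp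
    then obtain s where s: "s \<in> R" "n < length s" "s ! n"
      using N by (auto simp: reaches_def)
    then have "take (k (Suc j)) s \<in> ?W"
      using tree_take[OF splitting_tree_is_tree[OF R(1)]] n(1) by (simp add: level_def)
    then show False using n(2) s R(2) by blast
  qed
  moreover have "continuous_map (pairs_topology (branches S)) (discrete_topology UNIV) c"
    using continuous_map_first_diff[of "branches S" "\<lambda>d. even (stage d)"] by (simp add: c_def[abs_def])
  ultimately show ?thesis using S by blast
qed

end
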